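(* Let $p$ be a prime, $m\ge1$, and let $(\mathcal C_\star):\mathcal C_0\subseteq\mathcal C_1\subseteq\dots\subseteq\mathcal C_{m-1}\subseteq\mathbb F_p^N$ be a chain of cyclic codes (with $N=n$) or of extended cyclic codes (with $N=n+1$). Assume there is $\gamma\ge1$ such that $\mathrm{dist}_E(\mathcal C_i)\ge p^{2m-2i}/\gamma$ for all $0\le i\le m-1$. Then $\min\mathcal L(\widehat{(\mathcal C_\star)})\ge p^m/\gamma$.
   Context: Let $R=\mathbb Z/p^m\mathbb Z$ and $n\ge1$ with $p\nmid n$. Identify $\mathbb F_p[X]/(X^n-1)$ with $\mathbb F_p^n$ and $R[X]/(X^n-1)$ with $R^n$ via the basis $1,X,\dots,X^{n-1}$; a cyclic code is an ideal of $\mathbb F_p[X]/(X^n-1)$, generated by its unique monic generator polynomial $g\mid X^n-1$; by Hensel's lemma there is a unique monic $G\mid X^n-1$ in $R[X]$ with $G\equiv g\pmod p$. For a chain of cyclic codes $\mathcal C_0\subseteq\dots\subseteq\mathcal C_{m-1}$ with generator polynomials $g_j$ and lifts $G_j$, its lift $\widehat{(\mathcal C_\star)}$ is the ideal $(p^jG_j:0\le j\le m-1)$ of $R[X]/(X^n-1)\cong R^n$. The extended code of $\mathcal C\subseteq A^n$ ($A$ a ring) is $\{(c_1,\dots,c_n,-\sum c_i):(c_i)\in\mathcal C\}$; a chain of extended cyclic codes is the chain of extended codes of a chain of cyclic codes, and its lift is the extended code of the lift of the underlying cyclic chain. Let $b_1,\dots,b_N$ be an orthogonal basis of $\mathbb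 R^N$ with $(b_i,b_i)=p^{-m}$, $\Omega=\bigoplus\mathbb Zb_i$, and $\mathcal L(\widehat{(\mathcal C_\star)})=\{\sum a_ib_i:a_i\in\mathbb Z,(a_i+p^m\mathbb Z)_i\in\widehat{(\mathcal C_\star)}\}$ (Construction $\mathrm D^{(\mathrm{cyc})}$). The Euclidean weight of $c\in\mathbb F_p^N$ is $w_E(c)=\min\{\sum a_i^2:a_i\in\mathbb Z,a_i\equiv c_i\pmod p\}$, and $\mathrm{dist}_E(\mathcal C)=\min\{w_E(c):0\ne c\in\mathcal C\}$. $\min(L)=\min\{(x,x):0\ne x\in L\}$. *)

theory Defs
  imports
    "HOL-Analysis.Analysis"
    "HOL-Algebra.QuotRing"
    "HOL-Algebra.Algebraic_Closure_Type"
    "Berlekamp_Zassenhaus.Finite_Field"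
begin

text \<open>
  The ring \<open>\<int>/q\<int>\<close> is \<^typ>\<open>'q mod_ring\<close> with \<open>q = CARD('q)\<close>. Below, \<open>\<int>/p\<int>\<close> is
  \<open>'p mod_ring\<close> for \<open>'p :: prime_card\<close>, and \<open>R = \<int>/p\<^sup>m\<int>\<close> is \<open>'q mod_ring\<close> for a type
  \<open>'q\<close> with \<open>CARD('q) = CARD('p) ^ m\<close>. Words of length \<open>N\<close> over \<open>A\<close> are lists of length \<open>N\<close>.
\<close>

section \<open>Cyclic codes\<close>

abbreviation cyc_modulus :: "nat \<Rightarrow> 'a::comm_ring_1 poly" where
  "cyc_modulus n \<equiv> Polynomial.monom 1 n - 1"

abbreviation cyc_ideal :: "nat \<Rightarrow> 'a::comm_ring_1 poly set" where
  "cyc_ideal n \<equiv> PIdl\<^bsub>ring_of_type_algebra\<^esub> (cyc_modulus n)"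

text \<open>The quotient ring \<open>A[X]/(X\<^sup>n - 1)\<close>, whose elements are cosets of polynomials.\<close>

definition cyc_ring :: "nat \<Rightarrow> 'a::comm_ring_1 poly set ring" where
  "cyc_ring n = ring_of_type_algebra Quot (cyc_ideal n)"

definition cyc_class :: "nat \<Rightarrow> 'a::comm_ring_1 poly \<Rightarrow> 'a poly set" where
  "cyc_class n f = cyc_ideal n +>\<^bsub>ring_of_type_algebra\<^esub> f"

text \<open>
  The identification of \<open>A\<^sup>n\<close> with \<open>A[X]/(X\<^sup>n - 1)\<close> via the basis \<open>1, X, \<dots>, X\<^sup>n\<^sup>-\<^sup>1\<close>: it is only
  meant for words of length \<open>n\<close>, on which it is bijective.
\<close>

definition word_class :: "nat \<Rightarrow> 'a::comm_ring_1 list \<Rightarrow> 'a poly set" where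
  "word_class n c = cyc_class n (Poly c)"

definition cyclic_code :: "nat \<Rightarrow> 'a::comm_ring_1 list set \<Rightarrow> bool" where
  "cyclic_code n C \<longleftrightarrow> (\<forall>c\<in>C. length c = n) \<and> ideal (word_class n ` C) (cyc_ring n)"

definition generator_poly :: "nat \<Rightarrow> 'p::prime_card mod_ring list set \<Rightarrow> 'p mod_ring poly" where
  "generator_poly n C = (THE g. monic g \<and> g dvd cyc_modulus n \<and>
     word_class n ` C = PIdl\<^bsub>cyc_ring n\<^esub> (cyc_class n g))"

section \<open>Lifting to characteristic \<open>p\<^sup>m\<close>\<close>

text \<open>The reduction map \<open>\<int>/q\<int> \<rightarrow> \<int>/p\<int>\<close>; it is a ring homomorphism when \<open>p\<close> divides \<open>q\<close>.\<close>

definition reduce_mod :: "'q::nontriv mod_ring \<Rightarrow> 'p::nontriv mod_ring" where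
  "reduce_mod x = of_int (to_int_mod_ring x)"

definition hensel_lift :: "nat \<Rightarrow> 'p::prime_card mod_ring poly \<Rightarrow> 'q::nontriv mod_ring poly" where
  "hensel_lift n g = (THE G. monic G \<and> G dvd cyc_modulus n \<and> map_poly reduce_mod G = g)"

definition cyclic_chain :: "nat \<Rightarrow> nat \<Rightarrow> (nat \<Rightarrow> 'p::prime_card mod_ring list set) \<Rightarrow> bool" where
  "cyclic_chain m n C \<longleftrightarrow>
     (\<forall>j<m. cyclic_code n (C j)) \<and> (\<forall>i j. i \<le> j \<and> j < m \<longrightarrow> C i \<subseteq> C j)"

text \<open>The ideal \<open>(p\<^sup>j G\<^sub>j : 0 \<le> j \<le> m - 1)\<close> of \<open>R[X]/(X\<^sup>n - 1)\<close>, as a set of words in \<open>R\<^sup>n\<close>.\<close>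

definition cyclic_lift ::
    "nat \<Rightarrow> nat \<Rightarrow> (nat \<Rightarrow> 'p::prime_card mod_ring list set) \<Rightarrow> 'q::nontriv mod_ring list set" where
  "cyclic_lift m n C = {c. length c = n \<and>
     word_class n c \<in> Idl\<^bsub>cyc_ring n\<^esub>
       {cyc_class n (Polynomial.smult (of_nat CARD('p) ^ j) (hensel_lift n (generator_poly n (C j)))) | j. j < m}}"

definition extended_code :: "'a::comm_ring_1 list set \<Rightarrow> 'a list set" where
  "extended_code C = {c @ [- sum_list c] | c. c \<in> C}"

section \<open>Construction \<open>D\<^sup>(\<^sup>c\<^sup>y\<^sup>c\<^sup>)\<close>\<close>

definition orthogonal_basis :: "nat \<Rightarrow> (nat \<Rightarrow> 'v::euclidean_space) \<Rightarrow> bool" where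
  "orthogonal_basis N b \<longleftrightarrow>
     inj_on b {..<N} \<and> independent (b ` {..<N}) \<and> span (b ` {..<N}) = UNIV \<and>
     (\<forall>i<N. \<forall>j<N. i \<noteq> j \<longrightarrow> orthogonal (b i) (b j))"

definition construction_D ::
    "nat \<Rightarrow> (nat \<Rightarrow> 'v::euclidean_space) \<Rightarrow> 'q::nontriv mod_ring list set \<Rightarrow> 'v set" where
  "construction_D N b C =
     {\<Sum>i<N. of_int (a i) *\<^sub>R b i | a :: nat \<Rightarrow> int. map (\<lambda>i. of_int (a i)) [0..<N] \<in> C}"

text \<open>
  A minimum of norms over a discrete set, written as an infimum (it is attained when \<open>L\<close> is a
  nonzero lattice).
\<close>

definition min_norm :: "'v::euclidean_space set \<Rightarrow> real" where
  "min_norm L = Inf {x \<bullet> x | x. x \<in> L \<and> x \<noteq> 0}"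

section \<open>Euclidean weights\<close>

text \<open>On \<^typ>\<open>nat\<close>, the infimum of a nonempty set is its minimum.\<close>

definition euclidean_weight :: "'p::nontriv mod_ring list \<Rightarrow> nat" where
  "euclidean_weight c = Inf {nat (\<Sum>x\<leftarrow>a. x\<^sup>2) | a :: int list. map of_int a = c}"

text \<open>
  The minimum is extended-real valued so that the zero code, which has no nonzero word and may
  occur in a chain, has distance \<open>\<infinity>\<close>.
\<close>

definition euclidean_dist :: "'p::nontriv mod_ring list set \<Rightarrow> ereal" where
  "euclidean_dist C =
     (INF c \<in> {c \<in> C. c \<noteq> replicate (length c) 0}. ereal (real (euclidean_weight c)))"

end

theory Submission
  imports Defs
begin

text \<open>
  Write \<open>a = p\<^sup>k a'\<close> for an integer coordinate vector \<open>a\<close> of a nonzero lattice vector, with \<open>k\<close> maximal.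
  If \<open>k \<ge> m\<close>, then \<open>\<Sum> a\<^sub>i\<^sup>2 \<ge> p\<^sup>2\<^sup>m\<close>. Otherwise \<open>a'\<close> is nonzero modulo \<open>p\<close> and lies in \<open>C\<^sub>k\<close> modulo \<open>p\<close>:
  since \<open>G\<^sub>k\<close> divides \<open>G\<^sub>j\<close> for \<open>j \<le> k\<close>, every element of the lift is a multiple of \<open>G\<^sub>k\<close> modulo
  \<open>p\<^sup>k\<^sup>+\<^sup>1\<close>, and \<open>G\<^sub>k\<close> is monic, so the factor \<open>p\<^sup>k\<close> can be cancelled. Hence
  \<open>\<Sum> a\<^sub>i\<^sup>2 = p\<^sup>2\<^sup>k \<Sum> a'\<^sub>i\<^sup>2 \<ge> p\<^sup>2\<^sup>k p\<^sup>2\<^sup>m\<^sup>-\<^sup>2\<^sup>k / \<gamma>\<close>.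

  Divisibility among Hensel lifts holds because \<open>X\<^sup>n - 1\<close> is squarefree modulo \<open>p\<close>: coprimality of a
  factor and its cofactor lifts to comaximality, as \<open>p\<close> is nilpotent.
\<close>

hide_const (open) Polynomials.degree Polynomials.lead_coeff UnivPoly.coeff UnivPoly.monom Module.smult

section \<open>Cyclic codes and their generator polynomials\<close>

lemma cyc_ideal_eq: "(cyc_ideal n :: 'a::comm_ring_1 poly set) = {f. cyc_modulus n dvd f}"
  by (auto simp: cgenideal_def ring_of_type_algebra_def dvd_def mult.commute)

lemma ideal_cyc_ideal: "ideal (cyc_ideal n :: 'a::comm_ring_1 poly set) ring_of_type_algebra"
  by (rule cring.cgenideal_ideal[OF cring_from_type_algebra]) (simp add: ring_of_type_algebra_def)

lemma mem_cyc_class: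
  "h \<in> cyc_class n (f :: 'a::comm_ring_1 poly) \<longleftrightarrow> cyc_modulus n dvd h - f"
proof -
  have "cyc_class n f = {h. \<exists>i. cyc_modulus n dvd i \<and> h = i + f}"
    unfolding cyc_class_def a_r_coset_def' cyc_ideal_eq by (auto simp: ring_of_type_algebra_def)
  then show ?thesis
    by (auto intro!: exI[of _ "h - f"])
qed

lemma cyc_class_eq_iff:
  "cyc_class n f = cyc_class n g \<longleftrightarrow> cyc_modulus n dvd f - (g :: 'a::comm_ring_1 poly)"
proof
  assume "cyc_class n f = cyc_class n g"
  then show "cyc_modulus n dvd f - g"
    using mem_cyc_class[of f n f] mem_cyc_class[of f n g] by simp
next
  assume *: "cyc_modulus n dvd f - g"
  have "cyc_modulus n dvd h - f \<longleftrightarrow> cyc_modulus n dvd h - g" for h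
    using dvd_add_left_iff[OF *, of "h - f"] by simp
  then show "cyc_class n f = cyc_class n g"
    by (auto simp: mem_cyc_class)
qed

lemma cring_cyc_ring: "cring (cyc_ring n :: 'a::comm_ring_1 poly set ring)"
  unfolding cyc_ring_def
  by (rule ideal.quotient_is_cring[OF ideal_cyc_ideal cring_from_type_algebra])

lemma carrier_cyc_ring: "carrier (cyc_ring n) = range (cyc_class n :: 'a::comm_ring_1 poly \<Rightarrow> _)"
  by (auto simp: cyc_ring_def cyc_class_def FactRing_def A_RCOSETS_def' ring_of_type_algebra_def)

lemma cyc_class_mult:
  "cyc_class n f \<otimes>\<^bsub>cyc_ring n\<^esub> cyc_class n g = cyc_class n (f * (g :: 'a::comm_ring_1 poly))"
  using ring_hom_mult[OF ideal.rcos_ring_hom[OF ideal_cyc_ideal], of f g n]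
  by (simp add: cyc_ring_def cyc_class_def ring_of_type_algebra_def)

text \<open>As \<open>g\<close> divides \<open>X^n - 1\<close>, divisibility by \<open>g\<close> is
  the same for all representatives of a class. Membership in the quotient ideal thus becomes plain
  divisibility of polynomials.\<close>

lemma cyc_class_mem_PIdl_iff:
  fixes f g :: "'a::comm_ring_1 poly"
  assumes "g dvd cyc_modulus n"
  shows "cyc_class n f \<in> PIdl\<^bsub>cyc_ring n\<^esub> (cyc_class n g) \<longleftrightarrow> g dvd f"
proof -
  have "cyc_class n f \<in> PIdl\<^bsub>cyc_ring n\<^esub> (cyc_class n g) \<longleftrightarrow> (\<exists>a. cyc_modulus n dvd f - a * g)"
    by (simp add: cgenideal_def carrier_cyc_ring) (metis cyc_class_mult cyc_class_eq_iff rangeE rangeI)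
  also have "\<dots> \<longleftrightarrow> g dvd f"
  proof
    assume "\<exists>a. cyc_modulus n dvd f - a * g"
    then obtain a where "g dvd f - a * g"
      using assms dvd_trans by blast
    then show "g dvd f"
      by (metis diff_add_cancel dvd_add dvd_triv_right)
  next
    assume "g dvd f"
    then obtain a where "f = a * g"
      by (auto simp: dvd_def mult.commute)
    then have "cyc_modulus n dvd f - a * g"
      by simp
    then show "\<exists>a. cyc_modulus n dvd f - a * g" ..
  qed
  finally show ?thesis .
qed

text \<open>Negation is multiplication by \<open>- 1\<close>, so these three closure properties
  already give an additive subgroup.\<close>

lemma ideal_ring_of_type_algebraI:
  fixes J :: "'a::comm_ring_1 set"
  assumes "0 \<in> J" "\<And>f g. f \<in> J \<Longrightarrow> g \<in> J \<Longrightarrow> f + g \<in> J" "\<And>a f. f \<in> J \<Longrightarrow> a * f \<in> J"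
  shows "ideal J ring_of_type_algebra"
proof (rule idealI)
  have inv: "inv\<^bsub>add_monoid (ring_of_type_algebra :: 'a ring)\<^esub> f = - f" for f
  proof -
    interpret R: ring "ring_of_type_algebra :: 'a ring" by (rule ring_from_type_algebra)
    show ?thesis
      using R.minus_equality[of "- f" f] unfolding a_inv_def by (simp add: ring_of_type_algebra_def)
  qed
  show "subgroup J (add_monoid ring_of_type_algebra)"
  proof (rule subgroup.intro)
    show "inv\<^bsub>add_monoid ring_of_type_algebra\<^esub> f \<in> J" if "f \<in> J" for f
      using assms(3)[OF that, of "- 1"] inv[of f] by simp
  qed (auto simp: ring_of_type_algebra_def assms)
next
  fix a x assume "a \<in> J"
  then show "a \<otimes>\<^bsub>ring_of_type_algebra\<^esub> x \<in> J" "x \<otimes>\<^bsub>ring_of_type_algebra\<^esub> a \<in> J"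
    using assms(3)[of a x] by (simp_all add: ring_of_type_algebra_def mult.commute)
qed (rule ring_from_type_algebra)

lemma ideal_cyc_ringI:
  fixes J :: "'a::comm_ring_1 poly set"
  assumes "0 \<in> J" "\<And>f g. f \<in> J \<Longrightarrow> g \<in> J \<Longrightarrow> f + g \<in> J" "\<And>a f. f \<in> J \<Longrightarrow> a * f \<in> J"
  shows "ideal (cyc_class n ` J) (cyc_ring n)"
proof -
  interpret R: ring "ring_of_type_algebra :: 'a poly ring" by (rule ring_from_type_algebra)
  show ?thesis
    unfolding cyc_ring_def cyc_class_def
    by (rule R.ring_ideal_imp_quot_ideal[OF ideal_cyc_ideal ideal_ring_of_type_algebraI[OF assms]])
qed

text \<open>Ideals pull back along the quotient map. The preimage contains the kernel, so it has the
  element \<open>X^n - 1\<close> from which the search for a generator can start.\<close>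

lemma ideal_cyc_ring_vimage:
  fixes I :: "'a::comm_ring_1 poly set set"
  assumes "ideal I (cyc_ring n)"
  defines "J \<equiv> {f. cyc_class n f \<in> I}"
  shows "cyc_modulus n \<in> J" "f \<in> J \<Longrightarrow> g \<in> J \<Longrightarrow> f - g \<in> J" "f \<in> J \<Longrightarrow> a * f \<in> J"
proof -
  have J: "ideal J ring_of_type_algebra"
    using ring_hom_ring.ideal_vimage[OF ideal.rcos_ring_hom_ring[OF ideal_cyc_ideal]
      assms(1)[unfolded cyc_ring_def]]
    by (simp add: J_def cyc_class_def ring_of_type_algebra_def)
  interpret J: ideal J ring_of_type_algebra by (rule J)
  show mult: "a * f \<in> J" if "f \<in> J" for a f
    using J.I_l_closed[OF that, of a] by (simp add: ring_of_type_algebra_def)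
  show "f - g \<in> J" if "f \<in> J" "g \<in> J"
    using additive_subgroup.a_closed[OF J.additive_subgroup_axioms that(1) mult[OF that(2), of "- 1"]]
    by (simp add: ring_of_type_algebra_def)
  have "0 \<in> J"
    using additive_subgroup.zero_closed[OF J.additive_subgroup_axioms] by (simp add: ring_of_type_algebra_def)
  moreover have "cyc_class n (cyc_modulus n) = cyc_class n (0 :: 'a poly)"
    by (simp add: cyc_class_eq_iff)
  ultimately show "cyc_modulus n \<in> J"
    by (simp add: J_def)
qed

section \<open>Monic polynomials and principal ideals\<close>

text \<open>Zero divisors may lower the degree of a product, but the leading coefficient 1 of
  \<open>f\<close> leaves the top coefficient of the cofactor intact.\<close>

lemma monic_dvd_degree_le:
  fixes f g :: "'a::comm_ring_1 poly"
  assumes "monic f" "f dvd g" "g \<noteq> 0"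
  shows "degree f \<le> degree g"
proof -
  obtain q where q: "g = f * q"
    using assms(2) by auto
  with assms have "q \<noteq> 0" by auto
  then have "coeff (f * q) (degree f + degree q) \<noteq> 0"
    using assms(1) by (simp add: coeff_mult_degree_sum)
  then show ?thesis
    using le_degree[of g "degree f + degree q"] q by simp
qed

text \<open>Both have the same degree, so the leading terms cancel in \<open>g - f\<close>. A
  nonzero difference would be a multiple of \<open>f\<close> of smaller degree.\<close>

lemma monic_dvd_antisym:
  fixes f g :: "'a::comm_ring_1 poly"
  assumes "monic f" "monic g" "f dvd g" "g dvd f"
  shows "f = g"
proof (rule ccontr)
  assume ne: "f \<noteq> g"
  have "f \<noteq> 0" "g \<noteq> 0"
    using assms by auto
  then have deg: "degree f = degree g"
    using assms by (intro le_antisym monic_dvd_degree_le) auto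
  have "degree f \<le> degree (g - f)"
    using assms ne by (intro monic_dvd_degree_le) auto
  moreover have "degree (g - f) < degree f"
  proof -
    have "degree (g - f) \<le> degree f"
      using deg by (metis degree_diff_le order_refl)
    moreover have "coeff (g - f) (degree f) = 0"
      using assms deg by simp
    ultimately show ?thesis
      using ne by (metis eq_iff_diff_eq_0 leading_coeff_0_iff order_le_less)
  qed
  ultimately show False by simp
qed

text \<open>A nonzero element of least degree, made monic, divides every \<open>f\<close> in
  \<open>J\<close>: the remainder stays in \<open>J\<close> and has smaller degree.\<close>

lemma poly_ideal_principal:
  fixes J :: "'a::field poly set"
  assumes "f\<^sub>0 \<in> J" "f\<^sub>0 \<noteq> 0"
    and diff: "\<And>f g. f \<in> J \<Longrightarrow> g \<in> J \<Longrightarrow> f - g \<in> J"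
    and mult: "\<And>a f. f \<in> J \<Longrightarrow> a * f \<in> J"
  obtains g where "monic g" "J = {f. g dvd f}"
proof -
  obtain h where h: "h \<in> J" "h \<noteq> 0" and min: "\<And>f. f \<in> J \<Longrightarrow> f \<noteq> 0 \<Longrightarrow> degree h \<le> degree f"
    using ex_has_least_nat[of "\<lambda>f. f \<in> J \<and> f \<noteq> 0" f\<^sub>0 degree] assms(1,2) by blast
  define g where "g = smult (inverse (lead_coeff h)) h"
  have g: "g \<in> J"
    using mult[OF h(1), of "[:inverse (lead_coeff h):]"] by (simp add: g_def)
  have "monic g" "degree g = degree h"
    using h(2) by (simp_all add: g_def)
  moreover have "g dvd f" if "f \<in> J" for f
  proof -
    have "f mod g \<in> J"
      using diff[OF that mult[OF g, of "f div g"]] by (simp add: minus_div_mult_eq_mod)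
    moreover have "f mod g = 0 \<or> degree (f mod g) < degree g"
      using degree_mod_less[of g f] h(2) by (auto simp: g_def)
    ultimately show ?thesis
      using min[of "f mod g"] \<open>degree g = degree h\<close> by (metis dvd_eq_mod_eq_0 leD)
  qed
  moreover have "f \<in> J" if "g dvd f" for f
    using that mult[OF g] by (auto simp: dvd_def mult.commute)
  ultimately show ?thesis
    using that[of g] by blast
qed

section \<open>Existence and uniqueness of the generator polynomial\<close>

lemma monic_cyc_modulus:
  assumes "n \<ge> 1"
  shows "degree (cyc_modulus n :: 'a::comm_ring_1 poly) = n" "monic (cyc_modulus n :: 'a poly)"
proof -
  show deg: "degree (cyc_modulus n :: 'a poly) = n"
    using assms degree_add_eq_left[of "- 1" "monom 1 n :: 'a poly"] by (simp add: degree_monom_eq)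
  show "monic (cyc_modulus n :: 'a poly)"
    using assms by (simp add: deg)
qed

lemma subset_range_eq_iff:
  assumes "A \<subseteq> range h" "B \<subseteq> range h"
  shows "A = B \<longleftrightarrow> h -` A = h -` B"
  using assms by blast

text \<open>This justifies the definite description in \<open>generator_poly\<close>. Existence
  comes from the preimage ideal being principal, uniqueness from mutual divisibility of monic
  generators.\<close>

lemma generator_poly_unique:
  fixes C :: "'p::prime_card mod_ring list set"
  assumes "cyclic_code n C" "n \<ge> 1"
  shows "\<exists>!g. monic g \<and> g dvd cyc_modulus n \<and> word_class n ` C = PIdl\<^bsub>cyc_ring n\<^esub> (cyc_class n g)"
proof -
  let ?I = "word_class n ` C"
  let ?J = "{f. cyc_class n f \<in> ?I}"
  have I: "ideal ?I (cyc_ring n)"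
    using assms(1) by (simp add: cyclic_code_def)
  note J = ideal_cyc_ring_vimage[OF I]
  have ne: "(cyc_modulus n :: 'p mod_ring poly) \<noteq> 0"
    using monic_cyc_modulus(2)[OF assms(2), where 'a = "'p mod_ring"] by force
  obtain g where g: "monic g" "?J = {f. g dvd f}"
    by (rule poly_ideal_principal[OF J(1) ne J(2) J(3)])
  then have dvd: "g dvd cyc_modulus n"
    using J(1) by blast
  have sub: "?I \<subseteq> range (cyc_class n)"
    by (auto simp: word_class_def)
  \<comment> \<open>Both ideals lie in the range of the quotient map, so they are equal exactly when
    their preimages are; the preimage of \<open>(h)\<close> consists of the multiples of
    \<open>h\<close>.\<close>
  have gen: "?I = PIdl\<^bsub>cyc_ring n\<^esub> (cyc_class n h) \<longleftrightarrow> ?J = {f. h dvd f}"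
    if "h dvd cyc_modulus n" for h
  proof -
    have "PIdl\<^bsub>cyc_ring n\<^esub> (cyc_class n h) \<subseteq> range (cyc_class n)"
      by (auto simp: cgenideal_def carrier_cyc_ring cyc_class_mult)
    then have "?I = PIdl\<^bsub>cyc_ring n\<^esub> (cyc_class n h) \<longleftrightarrow>
        ?J = cyc_class n -` (PIdl\<^bsub>cyc_ring n\<^esub> (cyc_class n h))"
      using subset_range_eq_iff[OF sub] by (simp add: vimage_def)
    then show ?thesis
      by (simp add: vimage_def cyc_class_mem_PIdl_iff[OF that])
  qed
  show ?thesis
  proof (rule ex1I[of _ g])
    show "monic g \<and> g dvd cyc_modulus n \<and> ?I = PIdl\<^bsub>cyc_ring n\<^esub> (cyc_class n g)"
      using g dvd gen[OF dvd] by simp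
    show "h = g"
      if h: "monic h \<and> h dvd cyc_modulus n \<and> ?I = PIdl\<^bsub>cyc_ring n\<^esub> (cyc_class n h)" for h
    proof -
      have "{f. h dvd f} = {f. g dvd f}"
        using gen[of h] h unfolding g(2) by simp
      then have "h dvd g" "g dvd h"
        using dvd_refl by blast+
      then show "h = g"
        using h g(1) monic_dvd_antisym by blast
    qed
  qed
qed

lemma generator_poly:
  fixes C :: "'p::prime_card mod_ring list set"
  assumes "cyclic_code n C" "n \<ge> 1"
  shows "monic (generator_poly n C)" "generator_poly n C dvd cyc_modulus n"
    and "word_class n f \<in> word_class n ` C \<longleftrightarrow> generator_poly n C dvd Poly f"
    and "cyc_class n h \<in> word_class n ` C \<longleftrightarrow> generator_poly n C dvd h"
proof -
  note * = theI'[OF generator_poly_unique[OF assms], folded generator_poly_def]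
  show "monic (generator_poly n C)" and dvd: "generator_poly n C dvd cyc_modulus n"
    using * by auto
  show mem: "cyc_class n h \<in> word_class n ` C \<longleftrightarrow> generator_poly n C dvd h" for h
    using * cyc_class_mem_PIdl_iff[OF dvd] by simp
  show "word_class n f \<in> word_class n ` C \<longleftrightarrow> generator_poly n C dvd Poly f"
    using mem by (simp add: word_class_def)
qed

text \<open>The difference of the two polynomials has degree below \<open>n\<close> unless it is
  zero, yet it is divisible by a monic polynomial of degree \<open>n\<close>.\<close>

lemma word_class_inj:
  fixes c d :: "'a::comm_ring_1 list"
  assumes "length c = n" "length d = n" "n \<ge> 1" "word_class n c = word_class n d"
  shows "c = d"
proof -
  have dvd: "cyc_modulus n dvd Poly c - Poly d"
    using assms(4) by (simp add: word_class_def cyc_class_eq_iff)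
  have "Poly c - Poly d = 0"
  proof (rule ccontr)
    assume ne: "Poly c - Poly d \<noteq> 0"
    have "coeff (Poly c - Poly d) i = 0" if "i \<ge> n" for i
      using that assms(1,2) by (simp add: nth_default_beyond)
    with ne have "degree (Poly c - Poly d) < n"
      using leading_coeff_0_iff not_less by blast
    moreover have "n \<le> degree (Poly c - Poly d)"
      using monic_dvd_degree_le[OF monic_cyc_modulus(2)[OF assms(3)] dvd ne]
      by (simp only: monic_cyc_modulus(1)[OF assms(3)])
    ultimately show False
      by simp
  qed
  then have "coeff (Poly c) i = coeff (Poly d) i" for i
    by simp
  then have "nth_default 0 c i = nth_default 0 d i" for i
    by simp
  then have "c ! i = d ! i" if "i < n" for i
    using assms(1,2) that by (metis nth_default_nth)
  then show ?thesis
    using assms(1,2) by (simp add: list_eq_iff_nth_eq)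
qed

text \<open>Injectivity on words of length \<open>n\<close> turns membership of the class in the
  image ideal into membership of the word itself.\<close>

lemma mem_cyclic_code_iff:
  fixes C :: "'p::prime_card mod_ring list set"
  assumes "cyclic_code n C" "n \<ge> 1" "length c = n"
  shows "c \<in> C \<longleftrightarrow> generator_poly n C dvd Poly c"
proof -
  have "c \<in> C \<longleftrightarrow> word_class n c \<in> word_class n ` C"
  proof
    assume "word_class n c \<in> word_class n ` C"
    then obtain d where "d \<in> C" "word_class n c = word_class n d"
      by auto
    moreover have "length d = n"
      using assms(1) \<open>d \<in> C\<close> by (simp add: cyclic_code_def)
    ultimately show "c \<in> C"
      using word_class_inj[OF assms(3) _ assms(2)] by simp
  qed simp
  then show ?thesis
    using generator_poly(3)[OF assms(1,2)] by simp
qed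

lemma generator_poly_antimono:
  fixes C D :: "'p::prime_card mod_ring list set"
  assumes "cyclic_code n C" "cyclic_code n D" "n \<ge> 1" "C \<subseteq> D"
  shows "generator_poly n D dvd generator_poly n C"
proof -
  have "cyc_class n (generator_poly n C) \<in> word_class n ` C"
    by (simp add: generator_poly(4)[OF assms(1,3)])
  then have "cyc_class n (generator_poly n C) \<in> word_class n ` D"
    using assms(4) by blast
  then show ?thesis
    by (simp add: generator_poly(4)[OF assms(2,3)])
qed

section \<open>Reduction modulo \<open>p\<close> and Hensel lifting\<close>

text \<open>Pseudo-division multiplies the dividend by a power of the leading coefficient of
  \<open>g\<close>, which is 1 here.\<close>

lemma monic_division:
  fixes f g :: "'a::comm_ring_1 poly"
  assumes "monic g"
  obtains q r where "f = g * q + r" "r = 0 \<or> degree r < degree g"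
proof -
  obtain q r where "pseudo_divmod f g = (q, r)"
    by force
  moreover have "g \<noteq> 0"
    using assms by auto
  ultimately show ?thesis
    using pseudo_divmod[of g f q r] assms that by simp
qed

lemma of_int_mod_ring_eq_0_iff: "(of_int a :: 'a::nontriv mod_ring) = 0 \<longleftrightarrow> int CARD('a) dvd a"
  by transfer (simp add: dvd_eq_mod_eq_0)

lemma of_int_to_int_mod_ring [simp]: "of_int (to_int_mod_ring x) = (x :: 'a::nontriv mod_ring)"
  by (simp add: of_int_of_int_mod_ring)

text \<open>With \<open>F = X^n - 1\<close> one has \<open>X F' - n F = n\<close>, a nonzero
  constant. A common divisor of \<open>g\<close> and \<open>h\<close> divides both \<open>F\<close>
  and \<open>F'\<close>, hence this constant.\<close>

lemma coprime_cyc_modulus_factors: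
  fixes g h :: "'a::field poly"
  assumes "cyc_modulus n = g * h" "of_nat n \<noteq> (0::'a)"
  shows "coprime g h"
proof (rule coprimeI)
  fix d assume d: "d dvd g" "d dvd h"
  let ?F = "cyc_modulus n :: 'a poly"
  have "n \<ge> 1"
    using assms(2) by (cases n) auto
  have "d dvd pderiv ?F" "d dvd ?F"
    unfolding assms(1) using d by (simp_all add: pderiv_mult)
  then have "d dvd monom 1 1 * pderiv ?F - smult (of_nat n) ?F"
    by (rule dvd_diff[OF dvd_mult dvd_smult])
  also have "monom 1 1 * pderiv ?F - smult (of_nat n) ?F = [:of_nat n:]"
    using \<open>n \<ge> 1\<close>
    by (simp add: pderiv_diff pderiv_monom mult_monom smult_diff_right smult_monom)
  finally show "is_unit d"
    using assms(2) by (metis dvd_trans is_unit_triv)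
qed

text \<open>The setting is the reduction from \<open>R = Z/p^m\<close> to the field
  \<open>Z/p\<close>; the \<open>itself\<close> parameters tie the two types to the locale.\<close>

locale mod_ring_reduction =
  fixes ty_p :: "'p::prime_card itself" and ty_q :: "'q::nontriv itself" and p m :: nat
  assumes card_p: "CARD('p) = p" and card_q: "CARD('q) = p ^ m"
begin

abbreviation red :: "'q mod_ring poly \<Rightarrow> 'p mod_ring poly" where
  "red \<equiv> map_poly reduce_mod"

abbreviation \<pi> :: "'q mod_ring poly" where
  "\<pi> \<equiv> of_nat p"

lemma p_pos: "p > 0"
  using card_p zero_less_card_finite[where 'a = 'p] by simp

lemma of_nat_p [simp]: "(of_nat p :: 'p mod_ring) = 0"
  using of_nat_card_eq_0[where 'a = 'p] by (simp add: card_p)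

lemma m_pos: "m > 0"
  using card_q nontriv[where 'a = 'q] by (cases m) auto

text \<open>\<open>reduce_mod\<close> uses one chosen representative; any other differs by a
  multiple of \<open>p^m\<close>, hence of \<open>p\<close> because \<open>m > 0\<close>. The
  homomorphism laws then follow by writing every residue as \<open>of_int a\<close>.\<close>

lemma reduce_mod_of_int: "reduce_mod (of_int a :: 'q mod_ring) = (of_int a :: 'p mod_ring)"
proof -
  have "to_int_mod_ring (of_int a :: 'q mod_ring) = a mod int CARD('q)"
    by transfer simp
  moreover have "int p dvd a mod int CARD('q) - a"
  proof -
    have "int p dvd int CARD('q)"
      using card_q m_pos by simp
    moreover have "int CARD('q) dvd a mod int CARD('q) - a"
      by (simp add: mod_eq_dvd_iff[symmetric])
    ultimately show ?thesis
      by (rule dvd_trans)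
  qed
  then have "of_int (a mod int CARD('q) - a) = (0 :: 'p mod_ring)"
    unfolding of_int_mod_ring_eq_0_iff card_p .
  ultimately show ?thesis
    by (simp add: reduce_mod_def)
qed

sublocale reduce: comm_ring_hom "reduce_mod :: 'q mod_ring \<Rightarrow> 'p mod_ring"
proof
  fix x y :: "'q mod_ring"
  obtain a b where xy: "x = of_int a" "y = of_int b"
    by (metis of_int_to_int_mod_ring)
  show "reduce_mod (x + y) = (reduce_mod x + reduce_mod y :: 'p mod_ring)"
    unfolding xy of_int_add[symmetric] reduce_mod_of_int ..
  show "reduce_mod (x * y) = (reduce_mod x * reduce_mod y :: 'p mod_ring)"
    unfolding xy of_int_mult[symmetric] reduce_mod_of_int ..
  show "reduce_mod (0 :: 'q mod_ring) = (0 :: 'p mod_ring)"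
    using reduce_mod_of_int[of 0] by simp
  show "reduce_mod (1 :: 'q mod_ring) = (1 :: 'p mod_ring)"
    using reduce_mod_of_int[of 1] by simp
qed

sublocale red: map_poly_comm_ring_hom "reduce_mod :: 'q mod_ring \<Rightarrow> 'p mod_ring" ..

lemma coeff_red [simp]: "coeff (red f) i = reduce_mod (coeff f i)"
  by (simp add: coeff_map_poly)

lemma monic_red:
  assumes "monic G"
  shows "monic (red G)" "degree (red G) = degree G"
proof -
  have "coeff (red G) (degree G) = 1"
    using assms by simp
  then show deg: "degree (red G) = degree G"
    by (intro le_antisym degree_map_poly_le le_degree) simp
  then show "monic (red G)"
    using assms by simp
qed

lemma red_surj: obtains F where "red F = f"
proof
  show "red (map_poly (\<lambda>x. of_int (to_int_mod_ring x)) f) = f"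
    by (rule poly_eqI) (simp add: coeff_map_poly reduce_mod_of_int)
qed

lemma red_surj_monic:
  assumes "monic g"
  obtains G where "monic G" "red G = g"
proof
  let ?G = "map_poly (\<lambda>x. of_int (to_int_mod_ring x)) g :: 'q mod_ring poly"
  have "coeff ?G (degree g) = 1"
    using assms by (simp add: coeff_map_poly)
  then have "degree ?G = degree g"
    by (intro le_antisym degree_map_poly_le le_degree) simp
  then show "monic ?G"
    using \<open>coeff ?G (degree g) = 1\<close> by simp
  show "red ?G = g"
    by (rule poly_eqI) (simp add: coeff_map_poly reduce_mod_of_int)
qed

section \<open>Powers of \<open>p\<close> in \<open>R[X]\<close> and the kernel of reduction\<close>

lemma \<pi>_power: "\<pi> ^ k = [:of_nat p ^ k:]"
  by (induction k) (simp_all add: of_nat_poly one_pCons)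

lemma \<pi>_power_mult: "\<pi> ^ k * f = smult (of_nat p ^ k) f"
  by (simp add: \<pi>_power)

lemma \<pi>_power_m: "\<pi> ^ m = 0"
  using of_nat_card_eq_0[where 'a = 'q] by (simp add: \<pi>_power card_q)

lemma red_\<pi> [simp]: "red \<pi> = 0"
  by (rule poly_eqI) (simp add: of_nat_poly coeff_pCons reduce.hom_of_nat split: nat.split)

lemma red_eq_0E:
  assumes "red f = 0"
  obtains g where "f = \<pi> * g"
proof -
  \<comment> \<open>On residues whose integer representative is divisible by \<open>p\<close>, this
    is an exact division by \<open>p\<close>; applied to each coefficient it gives the
    cofactor.\<close>
  define quot where "quot x = (of_int (to_int_mod_ring x div int p) :: 'q mod_ring)"
    for x :: "'q mod_ring"
  have quot: "x = of_nat p * quot x" if "reduce_mod x = (0 :: 'p mod_ring)" for x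
  proof -
    have "int p dvd to_int_mod_ring x"
      using that by (simp add: reduce_mod_def of_int_mod_ring_eq_0_iff card_p)
    then have "of_int (int p * (to_int_mod_ring x div int p)) = x"
      by simp
    then show ?thesis
      by (simp add: quot_def)
  qed
  have "quot 0 = 0"
    by (simp add: quot_def)
  have "coeff f i = of_nat p * quot (coeff f i)" for i
    using assms by (intro quot) (metis coeff_0 coeff_red)
  then have "f = \<pi> ^ 1 * map_poly quot f"
    unfolding \<pi>_power_mult by (intro poly_eqI) (simp add: coeff_map_poly \<open>quot 0 = 0\<close>)
  then show ?thesis
    using that by simp
qed

text \<open>If \<open>p^m\<close> divides \<open>p^k a\<close> for an integer \<open>a\<close>, then
  \<open>p^(m - k)\<close> divides \<open>a\<close>, and \<open>m - k\<close> is positive.\<close>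

lemma reduce_mod_eq_0_of_mult_power:
  assumes "of_nat p ^ k * x = (0 :: 'q mod_ring)" "k < m"
  shows "reduce_mod x = (0 :: 'p mod_ring)"
proof -
  obtain a where x: "x = of_int a"
    by (metis of_int_to_int_mod_ring)
  have "of_int (int p ^ k * a) = (0 :: 'q mod_ring)"
    using assms(1) by (simp add: x)
  then have "int p ^ m dvd int p ^ k * a"
    unfolding of_int_mod_ring_eq_0_iff card_q by simp
  moreover have "int p ^ m = int p ^ k * int p ^ (m - k)"
    using assms(2) by (simp flip: power_add)
  ultimately have "int p ^ (m - k) dvd a"
    using p_pos by simp
  then have "int p dvd a"
    using assms(2) by (meson dvd_power dvd_trans zero_less_diff)
  then show ?thesis
    by (simp add: x reduce_mod_of_int of_int_mod_ring_eq_0_iff card_p)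
qed

lemma red_eq_0_of_mult_power:
  assumes "\<pi> ^ k * f = 0" "k < m"
  shows "red f = 0"
proof (rule poly_eqI)
  fix i
  have "of_nat p ^ k * coeff f i = 0"
    using assms(1) unfolding \<pi>_power_mult by (metis coeff_0 coeff_smult)
  then show "coeff (red f) i = coeff 0 i"
    using reduce_mod_eq_0_of_mult_power assms(2) by simp
qed

text \<open>This is how \<open>p^k\<close> gets cancelled although it is a zero divisor when
  \<open>k > 0\<close>. Let \<open>r\<close> be the remainder of \<open>f\<close> modulo
  \<open>G\<close>. Then \<open>G\<close> divides \<open>\<pi>^k r\<close>, whose degree is too
  small for a nonzero multiple of \<open>G\<close>, so \<open>\<pi>^k r = 0\<close> and
  \<open>r\<close> vanishes modulo \<open>p\<close>.\<close>

lemma red_dvd_of_dvd_mult_power: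
  assumes "monic G" "G dvd \<pi> ^ k * f" "k < m"
  shows "red G dvd red f"
proof -
  obtain q r where f: "f = G * q + r" and r: "r = 0 \<or> degree r < degree G"
    using monic_division[OF assms(1)] .
  have "\<pi> ^ k * f = G * (\<pi> ^ k * q) + \<pi> ^ k * r"
    by (simp add: f algebra_simps)
  then have "G dvd \<pi> ^ k * r"
    using assms(2) by (metis dvd_add_right_iff dvd_triv_left)
  have "\<pi> ^ k * r = 0"
  proof (rule ccontr)
    assume ne: "\<pi> ^ k * r \<noteq> 0"
    then have "degree G \<le> degree (\<pi> ^ k * r)"
      using monic_dvd_degree_le[OF assms(1) \<open>G dvd \<pi> ^ k * r\<close>] by simp
    also have "\<dots> \<le> degree r"
      unfolding \<pi>_power_mult by (rule degree_smult_le)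
    finally show False
      using r ne by auto
  qed
  then have "red r = 0"
    using red_eq_0_of_mult_power assms(3) by blast
  then show ?thesis
    by (simp add: f red.hom_add red.hom_mult)
qed

section \<open>Hensel factorisation over \<open>R\<close>\<close>

text \<open>Lifting the coefficients of a Bezout identity over the field leaves an error in the
  kernel of reduction, that is, a multiple of \<open>\<pi>\<close>.\<close>

lemma bezout_lift:
  assumes "coprime (red G) (red H)"
  obtains U V z where "U * G + V * H = 1 + \<pi> * z"
proof -
  obtain u v where uv: "u * red G + v * red H = 1"
    using assms bezout_coefficients_fst_snd[of "red G" "red H"] by auto
  obtain U V where "red U = u" "red V = v"
    using red_surj by metis
  then have "red (U * G + V * H - 1) = 0"
    using uv by (simp add: red.hom_add red.hom_mult red.hom_minus)
  then obtain z where "U * G + V * H - 1 = \<pi> * z"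
    by (rule red_eq_0E)
  then have "U * G + V * H = 1 + \<pi> * z"
    by (simp add: diff_eq_eq add.commute)
  then show ?thesis
    by (rule that)
qed

text \<open>Factorisations modulo \<open>\<pi>^(k + 1)\<close> are improved one power at a time,
  with the first factor kept monic.\<close>

lemma hensel_step:
  assumes "red F = g * h" "monic g" "coprime g h"
  shows "\<exists>G H w. monic G \<and> red G = g \<and> red H = h \<and> F = G * H + \<pi> ^ Suc k * w"
proof (induction k)
  case 0
  obtain G where G: "monic G" "red G = g"
    using red_surj_monic[OF assms(2)] .
  obtain H where H: "red H = h"
    by (rule red_surj)
  have "red (F - G * H) = 0"
    using assms(1) G H by (simp add: red.hom_minus red.hom_mult)
  then obtain w where "F - G * H = \<pi> * w"
    by (rule red_eq_0E)
  then have "F = G * H + \<pi> ^ Suc 0 * w"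
    by (simp add: diff_eq_eq add.commute)
  with G H show ?case
    by blast
next
  case (Suc k)
  then obtain G H w where G: "monic G" "red G = g" and H: "red H = h"
    and F: "F = G * H + \<pi> ^ Suc k * w"
    by blast
  obtain U V z where UV: "U * G + V * H = 1 + \<pi> * z"
    using bezout_lift[of G H] G H assms(3) by auto
  \<comment> \<open>Using \<open>r\<close> instead of \<open>w V\<close> as the correction of
    \<open>G\<close> keeps its degree below that of \<open>G\<close>, so that \<open>G'\<close>
    stays monic. The quotient \<open>q\<close> moves into the correction \<open>c\<close> of
    \<open>H\<close>.\<close>
  obtain q r where wV: "w * V = G * q + r" and r: "r = 0 \<or> degree r < degree G"
    using monic_division[OF G(1)] .
  define c where "c = w * U + q * H"
  define G' where "G' = G + \<pi> ^ Suc k * r"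
  define H' where "H' = H + \<pi> ^ Suc k * c"
  \<comment> \<open>The new error collects the Bezout defect \<open>\<pi> z\<close> and the product
    of the two corrections, which carries the factor \<open>\<pi>^(2k + 2)\<close>.\<close>
  define w' where "w' = - (w * z) - \<pi> ^ k * (r * c)"
  have "G * c + r * H = w * U * G + (G * q + r) * H"
    by (simp add: c_def algebra_simps)
  also have "\<dots> = w * (U * G + V * H)"
    unfolding wV[symmetric] by (simp add: algebra_simps)
  also have "\<dots> = w + \<pi> * (w * z)"
    unfolding UV by (simp add: algebra_simps)
  finally have c: "\<pi> ^ Suc k * (G * c + r * H) = \<pi> ^ Suc k * (w + \<pi> * (w * z))"
    by simp
  have "G' * H' + \<pi> ^ Suc (Suc k) * w'
      = G * H + \<pi> ^ Suc k * (G * c + r * H) - \<pi> ^ Suc k * (\<pi> * (w * z))"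
    by (simp add: G'_def H'_def w'_def algebra_simps)
  also have "\<dots> = F"
    unfolding c F by (simp add: algebra_simps)
  finally have "F = G' * H' + \<pi> ^ Suc (Suc k) * w'" ..
  moreover have "monic G'"
  proof (cases "r = 0")
    case False
    then have "degree (\<pi> ^ Suc k * r) < degree G"
      using r degree_smult_le[of _ r] unfolding \<pi>_power_mult by (meson order_le_less_trans)
    then show ?thesis
      using G(1) by (simp add: G'_def degree_add_eq_left coeff_eq_0)
  qed (use G in \<open>simp add: G'_def\<close>)
  moreover have "red G' = g" "red H' = h"
    using G H by (simp_all add: G'_def H'_def red.hom_add red.hom_mult)
  ultimately show ?case
    by blast
qed

text \<open>At precision \<open>m\<close> the error term is a multiple of
  \<open>\<pi>^m = 0\<close>.\<close>

lemma hensel_exists: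
  assumes "red F = g * h" "monic g" "coprime g h"
  obtains G where "monic G" "red G = g" "G dvd F"
proof -
  obtain G H w where "monic G" "red G = g" "F = G * H + \<pi> ^ Suc (m - 1) * w"
    using hensel_step[OF assms] by blast
  then show ?thesis
    using that \<pi>_power_m m_pos by simp
qed

text \<open>Divisibility modulo \<open>p\<close> makes \<open>red H'\<close> a factor of
  \<open>red H\<close>, so \<open>red G\<close> and \<open>red H'\<close> are coprime and
  \<open>U G + V H' = 1 + \<pi> z\<close>. Multiplying by \<open>G'\<close> and using
  \<open>G' H' = G H\<close> shows that \<open>G\<close> divides \<open>(1 + \<pi> z) G'\<close>,
  and \<open>1 + \<pi> z\<close> is a unit.\<close>

lemma dvd_of_red_dvd:
  assumes "F = G * H" "F = G' * H'" "coprime (red G) (red H)" "red G \<noteq> 0" "red G dvd red G'"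
  shows "G dvd G'"
proof -
  obtain d where d: "red G' = red G * d"
    using assms(5) by (rule dvdE)
  have "red G * red H = red (G' * H')"
    unfolding assms(2)[symmetric] assms(1) by (rule red.hom_mult[symmetric])
  also have "\<dots> = red G * (d * red H')"
    unfolding red.hom_mult d by (rule mult.assoc)
  finally have "red H = d * red H'"
    using assms(4) mult_left_cancel by blast
  then have "coprime (red G) (red H')"
    using assms(3) coprime_mult_right_iff by metis
  then obtain U V z where UV: "U * G + V * H' = 1 + \<pi> * z"
    by (rule bezout_lift)
  have "(- (\<pi> * z)) ^ m = \<pi> ^ m * (- z) ^ m"
    unfolding power_mult_distrib[symmetric] by simp
  also have "\<dots> = 0"
    by (simp only: \<pi>_power_m mult_zero_left)
  finally have nil: "(- (\<pi> * z)) ^ m = 0" .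
  \<comment> \<open>A finite geometric series inverts \<open>1 + \<pi> z\<close>, since
    \<open>\<pi> z\<close> is nilpotent.\<close>
  then have unit: "(1 + \<pi> * z) dvd 1"
    using one_diff_power_eq[of "- (\<pi> * z)" m] unfolding nil
    by (metis diff_minus_eq_add diff_zero dvd_triv_left)
  have "(1 + \<pi> * z) * G' = U * G * G' + V * (G' * H')"
    unfolding UV[symmetric] by (simp add: algebra_simps)
  also have "\<dots> = G * (U * G' + V * H)"
    unfolding assms(2)[symmetric] assms(1) by (simp add: algebra_simps)
  finally have dvd: "G dvd (1 + \<pi> * z) * G'"
    by simp
  obtain y where "1 = (1 + \<pi> * z) * y"
    using unit by (rule dvdE)
  then have "G' = (1 + \<pi> * z) * G' * y"
    by (metis mult.assoc mult.commute mult_1)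
  then show ?thesis
    using dvd by (metis dvd_mult2)
qed

section \<open>Divisors of \<open>X^n - 1\<close> and their Hensel lifts\<close>

lemma red_cyc_modulus: "red (cyc_modulus n) = cyc_modulus n"
  by (simp add: red.hom_minus map_poly_monom)

lemma of_nat_neq_0:
  assumes "\<not> p dvd n"
  shows "(of_nat n :: 'p mod_ring) \<noteq> 0"
  using of_int_mod_ring_eq_0_iff[of "int n", where 'a = 'p] assms by (simp add: card_p)

lemma dvd_of_red_dvd_cyc_modulus:
  assumes "\<not> p dvd n" "G dvd cyc_modulus n" "G' dvd cyc_modulus n" "monic G" "red G dvd red G'"
  shows "G dvd G'"
proof -
  obtain H H' where H: "cyc_modulus n = G * H" "cyc_modulus n = G' * H'"
    using assms(2,3) by (meson dvdE)
  have "cyc_modulus n = red G * red H"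
    unfolding red_cyc_modulus[symmetric] H(1) by (rule red.hom_mult)
  then have "coprime (red G) (red H)"
    by (rule coprime_cyc_modulus_factors[OF _ of_nat_neq_0[OF assms(1)]])
  moreover have "red G \<noteq> 0"
    using monic_red(1)[OF assms(4)] by force
  ultimately show ?thesis
    using dvd_of_red_dvd[OF H] assms(5) by blast
qed

text \<open>Two monic lifts of \<open>g\<close> have equal reductions, so each divides the
  other.\<close>

lemma hensel_lift_unique:
  assumes "\<not> p dvd n" "monic g" "g dvd cyc_modulus n"
  shows "\<exists>!G. monic G \<and> G dvd cyc_modulus n \<and> red G = g"
proof -
  obtain h where h: "cyc_modulus n = g * h"
    using assms(3) by (rule dvdE)
  obtain G where G: "monic G" "red G = g" "G dvd cyc_modulus n"
    using hensel_exists[OF _ assms(2) coprime_cyc_modulus_factors[OF h of_nat_neq_0[OF assms(1)]]]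
      red_cyc_modulus h by metis
  show ?thesis
  proof (rule ex1I[of _ G])
    fix G' assume "monic G' \<and> G' dvd cyc_modulus n \<and> red G' = g"
    then show "G' = G"
      using G dvd_of_red_dvd_cyc_modulus[OF assms(1), of G' G]
        dvd_of_red_dvd_cyc_modulus[OF assms(1), of G G'] monic_dvd_antisym[of G' G] by simp
  qed (use G in auto)
qed

lemma hensel_lift:
  assumes "\<not> p dvd n" "monic g" "g dvd cyc_modulus n"
  defines "G \<equiv> hensel_lift n g :: 'q mod_ring poly"
  shows "monic G" "G dvd cyc_modulus n" "red G = g"
  using theI'[OF hensel_lift_unique[OF assms(1-3)]] by (auto simp: G_def hensel_lift_def)

section \<open>Reducing words of the lifted code\<close>

lemma Poly_of_int_mult_power:
  "Poly (map of_int (map ((*) (int p ^ k)) xs)) = \<pi> ^ k * Poly (map of_int xs)"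
  unfolding \<pi>_power_mult
  by (rule poly_eqI) (auto simp: nth_default_def)

lemma red_Poly_of_int: "red (Poly (map of_int xs)) = Poly (map of_int xs)"
  by (rule poly_eqI) (auto simp: nth_default_def reduce_mod_of_int)

text \<open>The generators with \<open>j \<le> k\<close> are multiples of \<open>G\<^sub>k\<close>,
  because \<open>C j \<subseteq> C k\<close> reverses to divisibility of generators and of their
  lifts. Those with \<open>j > k\<close> are multiples of \<open>\<pi>^(k + 1)\<close>.\<close>

lemma cyclic_lift_dvd:
  fixes C :: "nat \<Rightarrow> 'p mod_ring list set"
  assumes n: "n \<ge> 1" "\<not> p dvd n"
    and C: "cyclic_chain m n C" and k: "k < m"
    and c: "c \<in> (cyclic_lift m n C :: 'q mod_ring list set)"
  shows "\<exists>r. hensel_lift n (generator_poly n (C k)) dvd Poly c - \<pi> ^ Suc k * r"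
proof -
  let ?G = "\<lambda>j. hensel_lift n (generator_poly n (C j)) :: 'q mod_ring poly"
  have code: "cyclic_code n (C j)" if "j < m" for j
    using C that by (simp add: cyclic_chain_def)
  have G: "monic (?G j)" "?G j dvd cyc_modulus n" "red (?G j) = generator_poly n (C j)"
    if "j < m" for j
    using hensel_lift[OF n(2) generator_poly(1,2)[OF code[OF that] n(1)]] by simp_all
  \<comment> \<open>\<open>J\<close> is the ideal of \<open>R[X]\<close> generated by
    \<open>G\<^sub>k\<close> and \<open>\<pi>^(k + 1)\<close>.\<close>
  define J where "J = {f. \<exists>r. ?G k dvd f - \<pi> ^ Suc k * r}"
  have JI: "f \<in> J" if "?G k dvd f - \<pi> ^ Suc k * r" for f r
    using that by (auto simp: J_def)
  have JE: thesis if "f \<in> J" "\<And>r. ?G k dvd f - \<pi> ^ Suc k * r \<Longrightarrow> thesis" for f thesis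
    using that by (auto simp: J_def)
  have ideal: "ideal (cyc_class n ` J) (cyc_ring n)"
  proof (rule ideal_cyc_ringI)
    show "0 \<in> J"
      by (rule JI[of _ 0]) simp
  next
    fix f g assume "f \<in> J" "g \<in> J"
    then obtain r s where "?G k dvd f - \<pi> ^ Suc k * r" "?G k dvd g - \<pi> ^ Suc k * s"
      by (meson JE)
    from dvd_add[OF this] show "f + g \<in> J"
      by (intro JI[of _ "r + s"]) (simp add: algebra_simps)
  next
    fix a f assume "f \<in> J"
    then obtain r where "?G k dvd f - \<pi> ^ Suc k * r"
      by (rule JE)
    from dvd_mult[OF this, of a] show "a * f \<in> J"
      by (intro JI[of _ "a * r"]) (simp add: algebra_simps)
  qed
  have gens: "smult (of_nat CARD('p) ^ j) (?G j) \<in> J" if j: "j < m" for j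
  proof (cases "j \<le> k")
    case True
    then have "C j \<subseteq> C k"
      using C k by (simp add: cyclic_chain_def)
    then have "generator_poly n (C k) dvd generator_poly n (C j)"
      by (rule generator_poly_antimono[OF code[OF j] code[OF k] n(1)])
    then have "red (?G k) dvd red (?G j)"
      unfolding G(3)[OF k] G(3)[OF j] .
    then have "?G k dvd ?G j"
      by (rule dvd_of_red_dvd_cyc_modulus[OF n(2) G(2)[OF k] G(2)[OF j] G(1)[OF k]])
    then have "?G k dvd smult (of_nat CARD('p) ^ j) (?G j)"
      by (rule dvd_smult)
    then show ?thesis
      by (intro JI[of _ 0]) simp
  next
    case False
    then have "\<pi> ^ j = \<pi> ^ Suc k * \<pi> ^ (j - Suc k)"
      by (simp flip: power_add del: power_Suc)
    then have "smult (of_nat CARD('p) ^ j) (?G j) - \<pi> ^ Suc k * (\<pi> ^ (j - Suc k) * ?G j) = 0"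
      unfolding card_p \<pi>_power_mult[symmetric] by (simp add: mult.assoc)
    then show ?thesis
      by (intro JI[of _ "\<pi> ^ (j - Suc k) * ?G j"]) (simp only: dvd_0_right)
  qed
  have "Idl\<^bsub>cyc_ring n\<^esub>
      {cyc_class n (smult (of_nat CARD('p) ^ j) (?G j)) | j. j < m} \<subseteq> cyc_class n ` J"
  proof (rule ring.genideal_minimal[OF cring.axioms(1)[OF cring_cyc_ring] ideal])
    show "{cyc_class n (smult (of_nat CARD('p) ^ j) (?G j)) | j. j < m} \<subseteq> cyc_class n ` J"
      using gens by blast
  qed
  moreover have "cyc_class n (Poly c) \<in> Idl\<^bsub>cyc_ring n\<^esub>
      {cyc_class n (smult (of_nat CARD('p) ^ j) (?G j)) | j. j < m}"
    using c unfolding cyclic_lift_def word_class_def by blast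
  ultimately have "cyc_class n (Poly c) \<in> cyc_class n ` J"
    by blast
  then obtain f where "f \<in> J" "cyc_class n (Poly c) = cyc_class n f"
    by (rule imageE)
  then have "cyc_modulus n dvd Poly c - f"
    by (simp add: cyc_class_eq_iff)
  \<comment> \<open>Passing to another representative is harmless because \<open>G\<^sub>k\<close>
    divides \<open>X^n - 1\<close>.\<close>
  then have *: "?G k dvd Poly c - f"
    by (rule dvd_trans[OF G(2)[OF k]])
  obtain r where "?G k dvd f - \<pi> ^ Suc k * r"
    using \<open>f \<in> J\<close> by (rule JE)
  from dvd_add[OF * this] show ?thesis
    by (intro exI[of _ r]) (simp add: algebra_simps)
qed

text \<open>After cancelling \<open>\<pi>^k\<close>, the term \<open>\<pi>^(k + 1) r\<close> still
  has one factor \<open>\<pi>\<close> and disappears under reduction.\<close>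

lemma cyclic_lift_reduce:
  fixes C :: "nat \<Rightarrow> 'p mod_ring list set"
  assumes n: "n \<ge> 1" "\<not> p dvd n"
    and C: "cyclic_chain m n C" and k: "k < m"
    and xs: "map of_int (map ((*) (int p ^ k)) xs) \<in> (cyclic_lift m n C :: 'q mod_ring list set)"
  shows "map of_int xs \<in> C k"
proof -
  let ?g = "generator_poly n (C k)"
  let ?G = "hensel_lift n ?g :: 'q mod_ring poly"
  have code: "cyclic_code n (C k)"
    using C k by (simp add: cyclic_chain_def)
  note G = hensel_lift[OF n(2) generator_poly(1,2)[OF code n(1)]]
  obtain r where "?G dvd Poly (map of_int (map ((*) (int p ^ k)) xs)) - \<pi> ^ Suc k * r"
    using cyclic_lift_dvd[OF n C k xs] by blast
  then have "?G dvd \<pi> ^ k * (Poly (map of_int xs) - \<pi> * r)"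
    unfolding Poly_of_int_mult_power by (simp add: algebra_simps)
  then have "red ?G dvd red (Poly (map of_int xs) - \<pi> * r)"
    by (rule red_dvd_of_dvd_mult_power[OF G(1) _ k])
  then have "?g dvd Poly (map of_int xs)"
    by (simp add: G(3) red.hom_minus red.hom_mult red_Poly_of_int)
  moreover have "length xs = n"
    using xs by (simp add: cyclic_lift_def)
  ultimately show ?thesis
    using mem_cyclic_code_iff[OF code n(1)] by simp
qed

text \<open>The first \<open>n\<close> coordinates are the cyclic case. The parity coordinate
  satisfies \<open>p^k (y + sum_list ys) = 0\<close> in \<open>R\<close>, and \<open>k < m\<close>
  forces \<open>y + sum_list ys\<close> to vanish modulo \<open>p\<close>.\<close>

lemma extended_lift_reduce:
  fixes D :: "nat \<Rightarrow> 'p mod_ring list set"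
  assumes n: "n \<ge> 1" "\<not> p dvd n"
    and D: "cyclic_chain m n D" and k: "k < m"
    and xs: "map of_int (map ((*) (int p ^ k)) xs)
      \<in> extended_code (cyclic_lift m n D :: 'q mod_ring list set)"
  shows "map of_int xs \<in> extended_code (D k)"
proof -
  have sum: "sum_list (map of_int ys) = (of_int (sum_list ys) :: 'a::ring_1)" for ys
    by (induction ys) auto
  obtain c where c: "c \<in> (cyclic_lift m n D :: 'q mod_ring list set)"
    and eq: "map of_int (map ((*) (int p ^ k)) xs) = c @ [- sum_list c]"
    using xs by (auto simp: extended_code_def)
  have "xs \<noteq> []"
    using eq by auto
  then obtain ys y where xs_eq: "xs = ys @ [y]"
    by (metis rev_exhaust)
  have c_eq: "c = map of_int (map ((*) (int p ^ k)) ys)"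
    and last: "of_int (int p ^ k * y) = - sum_list c"
    using eq by (simp_all add: xs_eq)
  have ys: "map of_int ys \<in> D k"
    using c unfolding c_eq by (rule cyclic_lift_reduce[OF n D k])
  have "of_int (int p ^ k * y) = (of_int (- (int p ^ k * sum_list ys)) :: 'q mod_ring)"
    unfolding last c_eq sum by (simp add: sum_list_const_mult)
  then have "of_nat p ^ k * of_int (y + sum_list ys) = (0 :: 'q mod_ring)"
    by (simp add: algebra_simps)
  then have "reduce_mod (of_int (y + sum_list ys) :: 'q mod_ring) = (0 :: 'p mod_ring)"
    using k by (rule reduce_mod_eq_0_of_mult_power)
  then have "of_int y = - (sum_list (map of_int ys) :: 'p mod_ring)"
    unfolding reduce_mod_of_int sum by (simp add: eq_neg_iff_add_eq_0)
  then show ?thesis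
    using ys by (auto simp: extended_code_def xs_eq)
qed

end

section \<open>Minimum norm\<close>

text \<open>The zero word places \<open>p^m\<close> times each basis vector in the lattice, so the
  infimum in \<open>min_norm\<close> is taken over a nonempty set.\<close>

lemma replicate_0_mem_cyclic_lift:
  fixes C :: "nat \<Rightarrow> 'p::prime_card mod_ring list set"
  shows "replicate n 0 \<in> (cyclic_lift m n C :: 'q::nontriv mod_ring list set)"
proof -
  have "Poly (replicate n 0) = (0 :: 'q mod_ring poly)"
    by (rule poly_eqI) (simp add: nth_default_def)
  moreover have "cyc_class n (0 :: 'q mod_ring poly) = \<zero>\<^bsub>cyc_ring n\<^esub>"
    by (auto simp: mem_cyc_class cyc_ring_def FactRing_def cyc_ideal_eq)
  moreover have "\<zero>\<^bsub>cyc_ring n\<^esub> \<in> Idl\<^bsub>cyc_ring n\<^esub> S" if "S \<subseteq> range (cyc_class n)"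
    for S :: "'q mod_ring poly set set"
  proof -
    interpret R: cring "cyc_ring n :: 'q mod_ring poly set ring"
      by (rule cring_cyc_ring)
    show ?thesis
      using that
      by (intro additive_subgroup.zero_closed ideal.axioms(1) R.genideal_ideal)
        (simp add: carrier_cyc_ring)
  qed
  moreover have "{cyc_class n (f j :: 'q mod_ring poly) | j. j < m} \<subseteq> range (cyc_class n)" for f
    by blast
  ultimately show ?thesis
    unfolding cyclic_lift_def word_class_def by (simp only: mem_Collect_eq length_replicate simp_thms)
qed

text \<open>The entry \<open>x\<close> makes the reduced word nonzero, and \<open>xs\<close> is one
  of the integer representatives over which its Euclidean weight is minimised.\<close>

lemma euclidean_dist_le_sum_squares:
  fixes C :: "'p::nontriv mod_ring list set"
  assumes "map of_int xs \<in> C" "x \<in> set xs" "\<not> int CARD('p) dvd x" "euclidean_dist C \<ge> ereal B"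
  shows "B \<le> real_of_int (\<Sum>x\<leftarrow>xs. x\<^sup>2)"
proof -
  let ?c = "map of_int xs :: 'p mod_ring list"
  have "?c \<noteq> replicate (length ?c) 0"
  proof
    assume "?c = replicate (length ?c) 0"
    moreover have "of_int x \<in> set ?c"
      using assms(2) by simp
    ultimately have "(of_int x :: 'p mod_ring) = 0"
      by (metis in_set_replicate)
    then show False
      using assms(3) by (simp add: of_int_mod_ring_eq_0_iff)
  qed
  then have "euclidean_dist C \<le> ereal (real (euclidean_weight ?c))"
    unfolding euclidean_dist_def using assms(1) by (intro INF_lower) auto
  with assms(4) have "B \<le> real (euclidean_weight ?c)"
    by (metis ereal_less_eq(3) order_trans)
  also have "euclidean_weight ?c \<le> nat (\<Sum>x\<leftarrow>xs. x\<^sup>2)"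
    unfolding euclidean_weight_def by (intro cInf_lower) auto
  then have "real (euclidean_weight ?c) \<le> real (nat (\<Sum>x\<leftarrow>xs. x\<^sup>2))"
    by simp
  also have "\<dots> = real_of_int (\<Sum>x\<leftarrow>xs. x\<^sup>2)"
  proof -
    have "(\<Sum>x\<leftarrow>xs. x\<^sup>2) \<ge> 0"
      by (induction xs) auto
    then show ?thesis
      by simp
  qed
  finally show ?thesis .
qed

lemma inner_orthogonal_basis:
  assumes "orthogonal_basis N b" "\<forall>i<N. b i \<bullet> b i = c"
  shows "(\<Sum>i<N. of_int (a i) *\<^sub>R b i) \<bullet> (\<Sum>i<N. of_int (a i) *\<^sub>R b i) = c * (\<Sum>i<N. (of_int (a i))\<^sup>2)"
proof -
  have "(\<Sum>i<N. of_int (a i) *\<^sub>R b i) \<bullet> (\<Sum>i<N. of_int (a i) *\<^sub>R b i)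
      = (\<Sum>i<N. \<Sum>j<N. of_int (a i) * (of_int (a j) * (b i \<bullet> b j)))"
    by (simp add: inner_sum_left inner_sum_right sum_distrib_left inner_commute mult.left_commute)
  also have "\<dots> = (\<Sum>i<N. \<Sum>j<N. if j = i then c * (of_int (a i))\<^sup>2 else 0)"
    using assms by (intro sum.cong refl) (auto simp: orthogonal_basis_def orthogonal_def power2_eq_square)
  also have "\<dots> = c * (\<Sum>i<N. (of_int (a i))\<^sup>2)"
    by (simp add: sum_distrib_left)
  finally show ?thesis .
qed

text \<open>Here \<open>k\<close> is the last exponent before divisibility of all coordinates first
  fails; the failure occurs at \<open>Suc k \<le> m\<close>.\<close>

lemma exact_common_power:
  fixes a :: "nat \<Rightarrow> int"
  assumes "\<not> (\<forall>i<N. q ^ m dvd a i)"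
  obtains k a' i where "k < m" "\<forall>i<N. a i = q ^ k * a' i" "i < N" "\<not> q dvd a' i"
proof -
  \<comment> \<open>The double negation is the form in which \<open>ex_least_nat_less\<close>
    returns the complement of the failure predicate.\<close>
  have "\<exists>k<m. (\<forall>i\<le>k. \<not> \<not> (\<forall>j<N. q ^ i dvd a j)) \<and> \<not> (\<forall>j<N. q ^ Suc k dvd a j)"
    using ex_least_nat_less[of "\<lambda>k. \<not> (\<forall>i<N. q ^ k dvd a i)" m] assms by simp
  then obtain k where k: "k < m" "\<forall>i<N. q ^ k dvd a i" "\<not> (\<forall>i<N. q ^ Suc k dvd a i)"
    by blast
  obtain a' where a': "\<forall>i<N. a i = q ^ k * a' i"
    using k(2) unfolding dvd_def by metis
  then have "\<exists>i<N. \<not> q dvd a' i"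
    using k(3) by (metis mult_dvd_mono dvd_refl power_Suc2)
  then show ?thesis
    using that k(1) a' by blast
qed

theorem theorem2p8:
  fixes p m n N :: nat
    and C :: "nat \<Rightarrow> 'p::prime_card mod_ring list set"
    and C_hat :: "'q::nontriv mod_ring list set"
    and b :: "nat \<Rightarrow> real ^ 'k"
    and \<gamma> :: real
  assumes "CARD('p) = p" and "m \<ge> 1" and "CARD('q) = p ^ m"
    and "n \<ge> 1" and "\<not> p dvd n"
    and "(N = n \<and> cyclic_chain m n C \<and> C_hat = cyclic_lift m n C) \<or>
         (N = n + 1 \<and>
           (\<exists>D. cyclic_chain m n D \<and> (\<forall>j<m. C j = extended_code (D j)) \<and>
                C_hat = extended_code (cyclic_lift m n D)))"
    and "CARD('k) = N" and "orthogonal_basis N b"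
    and "\<forall>i<N. b i \<bullet> b i = 1 / real p ^ m"
    and "\<gamma> \<ge> 1"
    and "\<forall>i<m. euclidean_dist (C i) \<ge> ereal (real p ^ (2 * m - 2 * i) / \<gamma>)"
  shows "min_norm (construction_D N b C_hat) \<ge> real p ^ m / \<gamma>"
proof -
  interpret mod_ring_reduction "TYPE('p)" "TYPE('q)" p m
    by standard fact+
  \<comment> \<open>From here on the cyclic and the extended case are treated together: only this
    reduction property and the zero word are used.\<close>
  have reduce: "map of_int xs \<in> C k"
    if "k < m" "map of_int (map ((*) (int p ^ k)) xs) \<in> C_hat" for k xs
    using assms(6)
  proof (elim disjE conjE exE)
    assume "cyclic_chain m n C" "C_hat = cyclic_lift m n C"
    with that show ?thesis
      by (intro cyclic_lift_reduce[OF assms(4,5)]) simp_all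
  next
    fix D assume "cyclic_chain m n D" "\<forall>j<m. C j = extended_code (D j)"
      "C_hat = extended_code (cyclic_lift m n D)"
    with that show ?thesis
      using extended_lift_reduce[OF assms(4,5), of D k xs] by simp
  qed
  have zero: "replicate N 0 \<in> C_hat"
    using assms(6)
  proof (elim disjE conjE exE)
    fix D assume "N = n + 1" "C_hat = extended_code (cyclic_lift m n D)"
    moreover have "replicate (n + 1) (0 :: 'q mod_ring) = replicate n 0 @ [- sum_list (replicate n 0)]"
      by (simp add: sum_list_replicate replicate_append_same)
    ultimately show ?thesis
      using replicate_0_mem_cyclic_lift by (auto simp: extended_code_def)
  qed (simp add: replicate_0_mem_cyclic_lift)
  \<comment> \<open>The bound is stated in integer coordinates; the factor \<open>p^(-m)\<close>
    from the norms of the basis vectors enters at the end.\<close>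
  have sum_ge: "real p ^ (2 * m) / \<gamma> \<le> (\<Sum>i<N. (of_int (a i))\<^sup>2)"
    if a: "map (\<lambda>i. of_int (a i)) [0..<N] \<in> C_hat" "i < N" "a i \<noteq> 0" for a i
  proof (cases "\<forall>i<N. int p ^ m dvd a i")
    case True
    then have "\<bar>int p ^ m\<bar> \<le> \<bar>a i\<bar>"
      using a(2,3) by (intro dvd_imp_le_int) auto
    then have "real_of_int \<bar>int p ^ m\<bar> \<le> real_of_int \<bar>a i\<bar>"
      by (simp only: of_int_le_iff)
    then have "(real p ^ m)\<^sup>2 \<le> \<bar>of_int (a i)\<bar>\<^sup>2"
      by (intro power_mono) simp_all
    also have "\<dots> \<le> (\<Sum>i<N. (of_int (a i))\<^sup>2)"
      using a(2) member_le_sum[of i "{..<N}" "\<lambda>i. (of_int (a i) :: real)\<^sup>2"] by simp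
    finally have "real p ^ (2 * m) \<le> (\<Sum>i<N. (of_int (a i))\<^sup>2)"
      by (simp add: power_mult mult.commute)
    \<comment> \<open>Here \<open>\<gamma> \<ge> 1\<close> enters: no code of the chain constrains
      vectors all of whose coordinates are divisible by \<open>p^m\<close>.\<close>
    moreover have "real p ^ (2 * m) / \<gamma> \<le> real p ^ (2 * m)"
      using assms(10) by (simp add: divide_le_eq mult_le_cancel_left1)
    ultimately show ?thesis
      by linarith
  next
    case False
    then obtain k a' j where k: "k < m" and a': "\<forall>i<N. a i = int p ^ k * a' i"
      and j: "j < N" "\<not> int p dvd a' j"
      by (rule exact_common_power)
    let ?xs = "map a' [0..<N]"
    have "map (\<lambda>i. of_int (a i)) [0..<N] = (map of_int (map ((*) (int p ^ k)) ?xs) :: 'q mod_ring list)"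
      using a' by simp
    then have "map of_int ?xs \<in> C k"
      using reduce[OF k] a(1) by metis
    then have "real p ^ (2 * m - 2 * k) / \<gamma> \<le> of_int (\<Sum>x\<leftarrow>?xs. x\<^sup>2)"
      using j assms(11) k by (intro euclidean_dist_le_sum_squares[of _ "C k" "a' j"]) (auto simp: card_p)
    also have "\<dots> = (\<Sum>i<N. (of_int (a' i))\<^sup>2)"
      by (simp add: interv_sum_list_conv_sum_set_nat o_def atLeast0LessThan)
    finally have "real p ^ (2 * k) * (real p ^ (2 * m - 2 * k) / \<gamma>) \<le> real p ^ (2 * k) * (\<Sum>i<N. (of_int (a' i))\<^sup>2)"
      by (intro mult_left_mono) auto
    also have "\<dots> = (\<Sum>i<N. (of_int (a i))\<^sup>2)"
      unfolding sum_distrib_left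
      by (intro sum.cong refl) (simp add: a' power_mult_distrib power_mult mult.commute)
    also have "real p ^ (2 * k) * (real p ^ (2 * m - 2 * k) / \<gamma>) = real p ^ (2 * m) / \<gamma>"
      using k by (simp flip: power_add)
    finally show ?thesis .
  qed
  show ?thesis
    unfolding min_norm_def
  proof (rule cInf_greatest)
    \<comment> \<open>The vector \<open>p^m b\<^sub>0\<close> reduces to the zero word and witnesses
      that the lattice has a nonzero element.\<close>
    let ?a = "\<lambda>i. if i = 0 then int p ^ m else 0"
    have "map (\<lambda>i. of_int (?a i)) [0..<N] = (replicate N 0 :: 'q mod_ring list)"
      using of_nat_card_eq_0[where 'a = 'q] by (intro nth_equalityI) (auto simp: card_q)
    then have "map (\<lambda>i. of_int (?a i)) [0..<N] \<in> C_hat"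
      using zero by (simp only:)
    then have "(\<Sum>i<N. of_int (?a i) *\<^sub>R b i) \<in> construction_D N b C_hat"
      unfolding construction_D_def by (intro CollectI exI[of _ ?a] conjI refl)
    moreover have "(\<Sum>i<N. of_int (?a i) *\<^sub>R b i) \<noteq> 0"
    proof -
      have N: "N > 0"
        using assms(7) by auto
      have "(\<Sum>i<N. (of_int (?a i))\<^sup>2) = (\<Sum>i<N. if i = 0 then (real p ^ m)\<^sup>2 else 0)"
        by (intro sum.cong) auto
      also have "\<dots> = (real p ^ m)\<^sup>2"
        using N by simp
      finally have "(\<Sum>i<N. of_int (?a i) *\<^sub>R b i) \<bullet> (\<Sum>i<N. of_int (?a i) *\<^sub>R b i) =
          1 / real p ^ m * (real p ^ m)\<^sup>2"
        by (simp only: inner_orthogonal_basis[OF assms(8,9)])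
      also have "\<dots> \<noteq> 0"
        using p_pos by simp
      finally show ?thesis
        by (simp only: inner_eq_zero_iff not_False_eq_True)
    qed
    ultimately show "{x \<bullet> x |x. x \<in> construction_D N b C_hat \<and> x \<noteq> 0} \<noteq> {}"
      by blast
  next
    fix y assume "y \<in> {x \<bullet> x |x. x \<in> construction_D N b C_hat \<and> x \<noteq> 0}"
    then obtain a where y: "y = (\<Sum>i<N. of_int (a i) *\<^sub>R b i) \<bullet> (\<Sum>i<N. of_int (a i) *\<^sub>R b i)"
      and a: "map (\<lambda>i. of_int (a i)) [0..<N] \<in> C_hat" "(\<Sum>i<N. of_int (a i) *\<^sub>R b i) \<noteq> 0"
      unfolding construction_D_def by blast
    obtain i where i: "i < N" "a i \<noteq> 0"
      using a(2) by (metis (no_types, lifting) lessThan_iff of_int_0 scaleR_zero_left sum.neutral)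
    have "real p ^ m / \<gamma> = 1 / real p ^ m * (real p ^ (2 * m) / \<gamma>)"
      using p_pos by (simp add: power_mult power2_eq_square mult_2 power_add)
    also have "\<dots> \<le> 1 / real p ^ m * (\<Sum>i<N. (of_int (a i))\<^sup>2)"
      using sum_ge[OF a(1) i] by (intro mult_left_mono) auto
    also have "\<dots> = y"
      unfolding y by (rule inner_orthogonal_basis[OF assms(8,9), symmetric])
    finally show "real p ^ m / \<gamma> \<le> y" .
  qed
qed

end
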